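(* Let $X$ be a separable Hilbert space, $N\ge1$, $\Lambda$ a lacunary set of nonnegative integers, and $f\in H^2_\Lambda(\mathbb{D},X)$ with $(\hat f(k))_{k\ge0}$ completely relatively compact in $X$. The following are equivalent: (i) $f$ is cyclic for $S^{*N}$ in $H^2(\mathbb{D},X)$; (ii) for every $m\ge0$, the closed linear span in $X^N$ of $\{(\hat f(Nk),\hat f(Nk+1),\dots,\hat f(Nk+N-1)) : k\ge m\}$ equals $X^N$.
   Context: $H^2(\mathbb{D},X)$: $X$-valued power series with square-summable coefficient norms; $H^2_\Lambda$ those with spectrum $\{k:\hat f(k)\neq0\}\subset\Lambda$. $\Lambda=\{n_1<n_2<\dots\}$ lacunary: $n_{k+1}/n_k\ge d>1$. $f$ is cyclic for $S^{*N}$ if the closed span of $\{S^{*Nk}f:k\ge0\}$ is $H^2(\mathbb{D},X)$, where $S^*$ is the backward shift. Completely relatively compact: for every orthogonal projection $P$ on $X$, $(P a_k/\|Pa_k\|)_{Pa_k\ne0}$ is relatively compact. *)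

theory Defs
  imports "HOL-Analysis.Analysis"
begin

text \<open>A complex Hilbert space is modelled as a real Hilbert space (class real_inner +
complete_space) together with a complex structure J (multiplication by the imaginary
unit): J is real-linear, J (J x) = - x, and J is a real isometry for the inner product.
The complex inner product is then inner x y + i * inner x (J y) (up to convention).\<close>

definition complex_structure :: "('a::real_inner \<Rightarrow> 'a) \<Rightarrow> bool" where
  "complex_structure J \<longleftrightarrow> linear J \<and> (\<forall>x. J (J x) = - x) \<and>
     (\<forall>x y. inner (J x) (J y) = inner x y)"

definition cscale :: "('a::real_vector \<Rightarrow> 'a) \<Rightarrow> complex \<Rightarrow> 'a \<Rightarrow> 'a" where
  "cscale J c x = Re c *\<^sub>R x + Im c *\<^sub>R J x"

definition separable_space :: "'a::metric_space itself \<Rightarrow> bool" where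
  "separable_space _ \<longleftrightarrow> (\<exists>D::'a set. countable D \<and> closure D = UNIV)"

text \<open>Elements of H^2(D,X) are identified with their Taylor coefficient sequences.\<close>
definition H2 :: "(nat \<Rightarrow> 'a::real_normed_vector) set" where
  "H2 = {a. summable (\<lambda>k. (norm (a k))\<^sup>2)}"

definition H2_norm :: "(nat \<Rightarrow> 'a::real_normed_vector) \<Rightarrow> real" where
  "H2_norm a = sqrt (\<Sum>k. (norm (a k))\<^sup>2)"

text \<open>Backward shift: (S* f)(z) = (f(z) - f(0))/z, i.e. shifting coefficients.\<close>
definition backward_shift :: "(nat \<Rightarrow> 'a) \<Rightarrow> nat \<Rightarrow> 'a" where
  "backward_shift a = (\<lambda>k. a (Suc k))"

definition spectrum_in :: "(nat \<Rightarrow> 'a::zero) \<Rightarrow> nat set \<Rightarrow> bool" where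
  "spectrum_in a \<Lambda> \<longleftrightarrow> {k. a k \<noteq> 0} \<subseteq> \<Lambda>"

definition lacunary :: "nat set \<Rightarrow> bool" where
  "lacunary \<Lambda> \<longleftrightarrow> (\<exists>n::nat \<Rightarrow> nat. strict_mono n \<and> \<Lambda> = range n \<and>
      (\<exists>d::real. d > 1 \<and> (\<forall>k. real (n (Suc k)) \<ge> d * real (n k))))"

definition cyclic_for_power_backward_shift ::
    "('a::real_normed_vector \<Rightarrow> 'a) \<Rightarrow> nat \<Rightarrow> (nat \<Rightarrow> 'a) \<Rightarrow> bool" where
  "cyclic_for_power_backward_shift J N f \<longleftrightarrow>
     (\<forall>g\<in>H2. \<forall>e>0. \<exists>K c. finite K \<and>
        H2_norm (\<lambda>j. g j - (\<Sum>k\<in>K. cscale J (c k)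
                   (((backward_shift ^^ N) ^^ k) f j))) < e)"

definition orth_projection :: "('a::real_inner \<Rightarrow> 'a) \<Rightarrow> ('a \<Rightarrow> 'a) \<Rightarrow> bool" where
  "orth_projection J P \<longleftrightarrow> bounded_linear P \<and> (\<forall>x. P (J x) = J (P x)) \<and>
     (\<forall>x. P (P x) = P x) \<and> (\<forall>x y. inner (P x) y = inner x (P y))"

definition completely_rel_compact :: "('a::real_inner \<Rightarrow> 'a) \<Rightarrow> (nat \<Rightarrow> 'a) \<Rightarrow> bool" where
  "completely_rel_compact J a \<longleftrightarrow>
     (\<forall>P. orth_projection J P \<longrightarrow>
        compact (closure {P (a k) /\<^sub>R norm (P (a k)) | k. P (a k) \<noteq> 0}))"

text \<open>The closed complex-linear span in X^N (elements: nat \<Rightarrow> 'a, components j < N, with the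
Hilbert norm sqrt of sum of squares) of {(a (N k), ..., a (N k + N - 1)) : k \<ge> m} is X^N.\<close>
definition blocks_span_XN ::
    "('a::real_normed_vector \<Rightarrow> 'a) \<Rightarrow> nat \<Rightarrow> (nat \<Rightarrow> 'a) \<Rightarrow> nat \<Rightarrow> bool" where
  "blocks_span_XN J N a m \<longleftrightarrow>
     (\<forall>y::nat \<Rightarrow> 'a. \<forall>e>0. \<exists>K c. finite K \<and> K \<subseteq> {m..} \<and>
        sqrt (\<Sum>j<N. (norm (y j - (\<Sum>k\<in>K. cscale J (c k) (a (N * k + j)))))\<^sup>2) < e)"

end

theory Submission
  imports Defs
begin

text \<open>
  For cyclicity it suffices that an \<open>h\<close> orthogonal to all \<open>S\<^sup>*\<^sup>N\<^sup>k f\<close> vanishes. For each residue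
  \<open>r\<close> modulo \<open>N\<close> let \<open>P r\<close> be the projection onto the closed complex span of the \<open>h j\<close> with
  \<open>j mod N = r\<close>, and put \<open>b n = P (n mod N) (f n)\<close>; replacing \<open>f\<close> by \<open>b\<close> does not affect the
  orthogonality relations. Since the gaps of \<open>\<Lambda>\<close> tend to infinity, Cauchy-Schwarz bounds
  \<open>\<bar>\<langle>b n, h j\<rangle>\<bar>\<^sup>2\<close>, for large \<open>n\<close> congruent to \<open>j\<close>, by the product of the tail \<open>R n\<close>, the sum of
  \<open>\<parallel>b l\<parallel>\<^sup>2\<close> over \<open>l > n\<close>, and \<open>G n\<close>, the sum of \<open>\<parallel>h (j + l - n)\<parallel>\<^sup>2\<close> over \<open>l > n\<close> in \<open>\<Lambda>\<close>. An
  integer is a difference of elements of a lacunary set in boundedly many ways, so \<open>G\<close> is summable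
  over \<open>\<Lambda>\<close>. By compactness of the normalised vectors, finitely many \<open>h j\<close> control \<open>\<parallel>b n\<parallel>\<^sup>2\<close>, and
  therefore the sum of \<open>\<parallel>b n\<parallel>\<^sup>2 / R n\<close> converges. If \<open>h\<close> were nonzero, the span condition would
  make infinitely many \<open>b n\<close> nonzero, and then that sum diverges.
\<close>

section \<open>Orthogonal projections\<close>


text \<open>A minimising sequence for the distance from \<open>x\<close> to \<open>W\<close> is
  Cauchy by the parallelogram law. Completeness gives it a limit, which is a nearest point, and
  minimality forces the residual to be orthogonal to \<open>W\<close>.\<close>

lemma orthogonal_projection_exists:
  fixes W :: "'b::{real_inner,complete_space} set"
  assumes sub: "subspace W" and cl: "closed W"
  shows "\<exists>y\<in>W. \<forall>w\<in>W. inner (x - y) w = 0"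
proof -
  define d where "d = infdist x W"
  have ne: "W \<noteq> {}" using subspace_0[OF sub] by auto
  have d0: "d \<ge> 0" unfolding d_def by (rule infdist_nonneg)
  have d_le: "d \<le> norm (x - w)" if "w \<in> W" for w
    unfolding d_def using infdist_le[OF that, of x] by (simp add: dist_norm)
  have "\<exists>y\<in>W. norm (x - y) < d + 1 / real (Suc n)" for n
  proof -
    have "Inf (dist x ` W) < d + 1 / real (Suc n)"
      using ne by (simp add: d_def infdist_def)
    then show ?thesis
      using cInf_lessD[of "dist x ` W"] ne by (force simp: dist_norm)
  qed
  then obtain y where yW: "\<And>n. y n \<in> W" and yd: "\<And>n. norm (x - y n) < d + 1 / real (Suc n)"
    by metis
  have close: "(norm (y m - y n))\<^sup>2 \<le> (8 * d + 4) / real (Suc M)" if "m \<ge> M" "n \<ge> M" for m n M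
  proof -
    define e where "e = 1 / real (Suc M)"
    have e: "0 < e" "e \<le> 1" by (auto simp: e_def)
    have bd: "(norm (x - y i))\<^sup>2 \<le> (d + e)\<^sup>2" if "i \<ge> M" for i
    proof (rule power_mono)
      have "1 / real (Suc i) \<le> e" unfolding e_def using that by (intro divide_left_mono) auto
      then show "norm (x - y i) \<le> d + e" using yd[of i] by linarith
    qed simp
    \<comment> \<open>The midpoint stays in \<open>W\<close>, so it is at distance at least
      \<open>d\<close> from \<open>x\<close>; this is the term subtracted in the parallelogram
      identity.\<close>
    have mid: "(1/2) *\<^sub>R (y m + y n) \<in> W"
      using yW sub by (simp add: subspace_add subspace_scale)
    have "d\<^sup>2 \<le> (norm (x - (1/2) *\<^sub>R (y m + y n)))\<^sup>2"
      by (rule power_mono[OF d_le[OF mid] d0])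
    moreover have "(norm (y m - y n))\<^sup>2 = 2 * (norm (x - y m))\<^sup>2 + 2 * (norm (x - y n))\<^sup>2
        - 4 * (norm (x - (1/2) *\<^sub>R (y m + y n)))\<^sup>2"
      by (simp add: power2_norm_eq_inner algebra_simps inner_commute)
    ultimately have "(norm (y m - y n))\<^sup>2 \<le> 4 * (d + e)\<^sup>2 - 4 * d\<^sup>2"
      using bd[OF that(1)] bd[OF that(2)] by linarith
    also have "\<dots> = (8 * d + 4 * e) * e" by (simp add: power2_eq_square algebra_simps)
    also have "\<dots> \<le> (8 * d + 4) * e" using e by (intro mult_right_mono) auto
    finally show ?thesis by (simp add: e_def)
  qed
  have "Cauchy y"
  proof (rule metric_CauchyI)
    fix r :: real assume r: "r > 0"
    obtain M where M: "(8 * d + 4) / r\<^sup>2 < real M" using reals_Archimedean2 by blast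
    then have "(8 * d + 4) / r\<^sup>2 < real (Suc M)" by simp
    then have "(8 * d + 4) / real (Suc M) < r\<^sup>2"
      using r by (simp add: field_simps)
    then have "dist (y m) (y n) < r" if "m \<ge> M" "n \<ge> M" for m n
      using close[OF that] r by (simp add: dist_norm power2_less_imp_less)
    then show "\<exists>M. \<forall>m\<ge>M. \<forall>n\<ge>M. dist (y m) (y n) < r" by blast
  qed
  then obtain z where z: "y \<longlonglongrightarrow> z"
    using Cauchy_convergent convergent_def by blast
  have zW: "z \<in> W" using closed_sequentially[OF cl _ z] yW by auto
  have "(\<lambda>n. d + 1 / real (Suc n)) \<longlonglongrightarrow> d + 0"
    by (intro tendsto_add tendsto_const LIMSEQ_Suc[OF lim_1_over_n])
  moreover have "(\<lambda>n. norm (x - y n)) \<longlonglongrightarrow> norm (x - z)"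
    by (intro tendsto_intros z)
  ultimately have zd: "norm (x - z) \<le> d"
    using LIMSEQ_le[of "\<lambda>n. norm (x - y n)" _ "\<lambda>n. d + 1 / real (Suc n)"] yd
    by (force intro: less_imp_le)
  have "inner (x - z) w = 0" if w: "w \<in> W" for w
  proof (rule ccontr)
    assume ne0: "inner (x - z) w \<noteq> 0"
    then have w0: "inner w w > 0" by (metis inner_gt_zero_iff inner_zero_right)
    \<comment> \<open>This \<open>t\<close> minimises the distance from \<open>x\<close> to the line
      through \<open>z\<close> in direction \<open>w\<close>.\<close>
    define t where "t = inner (x - z) w / inner w w"
    have "norm (x - z) \<le> norm (x - (z + t *\<^sub>R w))"
      using zd d_le[of "z + t *\<^sub>R w"] zW w sub by (meson order_trans subspace_add subspace_scale)
    then have "(norm (x - z))\<^sup>2 \<le> (norm (x - z - t *\<^sub>R w))\<^sup>2"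
      by (simp add: power_mono diff_diff_eq)
    also have "\<dots> = (norm (x - z))\<^sup>2 - 2 * t * inner (x - z) w + t * (t * inner w w)"
      by (simp add: power2_norm_eq_inner inner_diff inner_commute algebra_simps)
    also have "t * inner w w = inner (x - z) w" using w0 by (simp add: t_def)
    finally have "t * inner (x - z) w \<le> 0" by simp
    moreover have "t * inner (x - z) w = (inner (x - z) w)\<^sup>2 / inner w w"
      by (simp add: t_def power2_eq_square)
    moreover have "\<dots> > 0" using ne0 w0 by simp
    ultimately show False by simp
  qed
  then show ?thesis using zW by blast
qed

lemma subspace_closure:
  fixes V :: "'b::real_normed_vector set"
  assumes "subspace V"
  shows "subspace (closure V)"
proof (rule subspaceI)
  show "0 \<in> closure V" using assms closure_subset subspace_0 by blast
next
  fix x y assume "x \<in> closure V" "y \<in> closure V"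
  then obtain u v where "\<forall>n. u n \<in> V" "u \<longlonglongrightarrow> x" "\<forall>n. v n \<in> V" "v \<longlonglongrightarrow> y"
    unfolding closure_sequential by blast
  then show "x + y \<in> closure V"
    unfolding closure_sequential using assms
    by (intro exI[of _ "\<lambda>n. u n + v n"]) (auto intro: tendsto_add subspace_add)
next
  fix c x assume "x \<in> closure V"
  then obtain u where "\<forall>n. u n \<in> V" "u \<longlonglongrightarrow> x"
    unfolding closure_sequential by blast
  then show "c *\<^sub>R x \<in> closure V"
    unfolding closure_sequential using assms
    by (intro exI[of _ "\<lambda>n. c *\<^sub>R u n"]) (auto intro: tendsto_scaleR subspace_scale)
qed

text \<open>The residual of projecting any \<open>x\<close> onto the closure of \<open>V\<close> is
  orthogonal to \<open>V\<close>, hence zero.\<close>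

lemma closure_subspace_eq_UNIV:
  fixes V :: "'b::{real_inner,complete_space} set"
  assumes sub: "subspace V" and orth: "\<And>h. (\<And>v. v \<in> V \<Longrightarrow> inner h v = 0) \<Longrightarrow> h = 0"
  shows "closure V = UNIV"
proof -
  have "x \<in> closure V" for x
  proof -
    obtain y where y: "y \<in> closure V" "\<forall>w\<in>closure V. inner (x - y) w = 0"
      using orthogonal_projection_exists[of "closure V" x] sub by (auto simp: subspace_closure)
    have "x - y = 0" using y(2) closure_subset by (intro orth) blast
    then show ?thesis using y(1) by simp
  qed
  then show ?thesis by blast
qed

text \<open>Apply the isometry property to \<open>x\<close> and \<open>J y\<close>, using
  \<open>J (J y) = - y\<close>.\<close>

lemma complex_structure_inner: "complex_structure J \<Longrightarrow> inner (J x) y = - inner x (J y)"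
  unfolding complex_structure_def by (metis inner_minus_left)

definition proj_on :: "'b::real_inner set \<Rightarrow> 'b \<Rightarrow> 'b" where
  "proj_on W x = (SOME y. y \<in> W \<and> (\<forall>w\<in>W. inner (x - y) w = 0))"

context
  fixes W :: "'b::{real_inner,complete_space} set"
  assumes sub: "subspace W" and cl: "closed W"
begin

lemma proj_on_mem: "proj_on W x \<in> W"
  and proj_on_orthogonal: "w \<in> W \<Longrightarrow> inner (x - proj_on W x) w = 0"
proof -
  have "\<exists>y. y \<in> W \<and> (\<forall>w\<in>W. inner (x - y) w = 0)"
    using orthogonal_projection_exists[OF sub cl] by blast
  from someI_ex[OF this]
  show "proj_on W x \<in> W" "w \<in> W \<Longrightarrow> inner (x - proj_on W x) w = 0"
    unfolding proj_on_def by blast+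
qed

lemma inner_proj_on: "w \<in> W \<Longrightarrow> inner (proj_on W x) w = inner x w"
  using proj_on_orthogonal[of w x] by (simp add: inner_diff_left)

lemma proj_on_eqI:
  assumes "y \<in> W" "\<And>w. w \<in> W \<Longrightarrow> inner y w = inner x w"
  shows "proj_on W x = y"
proof -
  have "proj_on W x - y \<in> W" using assms(1) proj_on_mem sub by (simp add: subspace_diff)
  then have "inner (proj_on W x - y) (proj_on W x - y) = 0"
    using assms(2) inner_proj_on by (simp add: inner_diff_left)
  then show ?thesis by simp
qed

lemma norm_proj_on_le: "norm (proj_on W x) \<le> norm x"
proof -
  have "(norm (proj_on W x))\<^sup>2 = inner x (proj_on W x)"
    using inner_proj_on[OF proj_on_mem] by (simp add: power2_norm_eq_inner)
  also have "\<dots> \<le> norm x * norm (proj_on W x)" by (rule norm_cauchy_schwarz)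
  finally show ?thesis
    by (metis mult_le_cancel_right norm_ge_zero norm_zero order_le_less power2_eq_square)
qed

text \<open>Invariance of \<open>W\<close> under \<open>J\<close> makes the real projection commute
  with \<open>J\<close>, as required of the projections over which
  \<open>completely_rel_compact\<close> quantifies.\<close>

lemma orth_projection_proj_on:
  assumes J: "complex_structure J" and inv: "\<And>w. w \<in> W \<Longrightarrow> J w \<in> W"
  shows "orth_projection J (proj_on W)"
proof -
  have "bounded_linear (proj_on W)"
  proof (rule bounded_linear_intro[where K = 1])
    show "proj_on W (x + y) = proj_on W x + proj_on W y" for x y
      by (rule proj_on_eqI) (auto simp: inner_add_left inner_proj_on proj_on_mem subspace_add[OF sub])
    show "proj_on W (r *\<^sub>R x) = r *\<^sub>R proj_on W x" for r x
      by (rule proj_on_eqI) (auto simp: inner_proj_on proj_on_mem subspace_scale[OF sub])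
  qed (simp add: norm_proj_on_le)
  moreover have "proj_on W (J x) = J (proj_on W x)" for x
    by (rule proj_on_eqI) (auto simp: inner_proj_on proj_on_mem inv complex_structure_inner[OF J])
  moreover have "proj_on W (proj_on W x) = proj_on W x" for x
    by (rule proj_on_eqI) (auto simp: proj_on_mem)
  moreover have "inner (proj_on W x) y = inner x (proj_on W y)" for x y
    using inner_proj_on[OF proj_on_mem, of x y] inner_proj_on[OF proj_on_mem, of y x]
    by (simp add: inner_commute)
  ultimately show ?thesis unfolding orth_projection_def by blast
qed

end

section \<open>The Hardy space as a Hilbert space\<close>

lemma H2_zero: "(\<lambda>_. 0) \<in> H2"
  by (simp add: H2_def)

lemma H2_add:
  assumes "a \<in> H2" "b \<in> H2"
  shows "(\<lambda>k. a k + b k) \<in> H2"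
proof -
  have "(norm (u + v))\<^sup>2 \<le> 2 * (norm u)\<^sup>2 + 2 * (norm v)\<^sup>2" for u v :: 'a
  proof -
    have "(norm (u + v))\<^sup>2 \<le> (norm u + norm v)\<^sup>2"
      by (intro power_mono norm_triangle_ineq) simp
    also have "\<dots> \<le> 2 * (norm u)\<^sup>2 + 2 * (norm v)\<^sup>2"
      using zero_le_power2[of "norm u - norm v"] by (simp add: power2_eq_square algebra_simps)
    finally show ?thesis .
  qed
  moreover have "summable (\<lambda>k. 2 * (norm (a k))\<^sup>2 + 2 * (norm (b k))\<^sup>2)"
    using assms by (intro summable_add summable_mult) (auto simp: H2_def)
  ultimately show ?thesis
    unfolding H2_def by (auto intro: summable_comparison_test')
qed

lemma H2_scaleR: "a \<in> H2 \<Longrightarrow> (\<lambda>k. r *\<^sub>R a k) \<in> H2"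
  by (simp add: H2_def power_mult_distrib summable_mult)

lemma H2_norm_le:
  assumes "a \<in> H2" "\<And>k. norm (b k) \<le> norm (a k)"
  shows "b \<in> H2"
  using assms unfolding H2_def
  by (auto intro!: summable_comparison_test'[of "\<lambda>k. (norm (a k))\<^sup>2"] power_mono)

lemma H2_uminus: "a \<in> H2 \<Longrightarrow> (\<lambda>k. - a k) \<in> H2"
  by (simp add: H2_def)

lemma H2_diff: "a \<in> H2 \<Longrightarrow> b \<in> H2 \<Longrightarrow> (\<lambda>k. a k - b k) \<in> H2"
  using H2_add[OF _ H2_uminus, of a b] by simp

lemma H2_ignore_initial: "a \<in> H2 \<Longrightarrow> (\<lambda>k. a (k + n)) \<in> H2"
  by (simp add: H2_def summable_iff_shift[of "\<lambda>k. (norm (a k))\<^sup>2"])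

lemma H2_summable_inner:
  fixes a b :: "nat \<Rightarrow> 'a::real_inner"
  assumes "a \<in> H2" "b \<in> H2"
  shows "summable (\<lambda>k. inner (a k) (b k))"
proof (rule summable_comparison_test')
  show "summable (\<lambda>k. (norm (a k))\<^sup>2 + (norm (b k))\<^sup>2)"
    using assms by (intro summable_add) (auto simp: H2_def)
  fix k
  have "norm (inner (a k) (b k)) \<le> norm (a k) * norm (b k)"
    by (simp add: Cauchy_Schwarz_ineq2)
  also have "\<dots> \<le> (norm (a k))\<^sup>2 + (norm (b k))\<^sup>2"
  proof -
    have "2 * (norm (a k) * norm (b k)) \<le> (norm (a k))\<^sup>2 + (norm (b k))\<^sup>2"
      using zero_le_power2[of "norm (a k) - norm (b k)"] by (simp add: power2_eq_square algebra_simps)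
    moreover have "0 \<le> norm (a k) * norm (b k)" by simp
    ultimately show ?thesis by linarith
  qed
  finally show "norm (inner (a k) (b k)) \<le> (norm (a k))\<^sup>2 + (norm (b k))\<^sup>2" .
qed

text \<open>\<^const>\<open>H2\<close> is made a type so that the projection theorem applies to it.\<close>

typedef (overloaded) 'a hardy = "H2 :: (nat \<Rightarrow> 'a::real_inner) set"
  morphisms coeff Hardy
  using H2_zero by blast

lemma hardy_eqI: "(\<And>k. coeff x k = coeff y k) \<Longrightarrow> x = y"
  by (simp add: coeff_inject[symmetric] ext)

instantiation hardy :: (real_inner) real_inner
begin

definition zero_hardy :: "'a hardy" where "0 = Hardy (\<lambda>_. 0)"
definition plus_hardy :: "'a hardy \<Rightarrow> 'a hardy \<Rightarrow> 'a hardy" where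
  "x + y = Hardy (\<lambda>k. coeff x k + coeff y k)"
definition minus_hardy :: "'a hardy \<Rightarrow> 'a hardy \<Rightarrow> 'a hardy" where
  "x - y = Hardy (\<lambda>k. coeff x k - coeff y k)"
definition uminus_hardy :: "'a hardy \<Rightarrow> 'a hardy" where
  "- x = Hardy (\<lambda>k. - coeff x k)"
definition scaleR_hardy :: "real \<Rightarrow> 'a hardy \<Rightarrow> 'a hardy" where
  "r *\<^sub>R x = Hardy (\<lambda>k. r *\<^sub>R coeff x k)"
definition inner_hardy :: "'a hardy \<Rightarrow> 'a hardy \<Rightarrow> real" where
  "inner x y = (\<Sum>k. inner (coeff x k) (coeff y k))"
definition norm_hardy :: "'a hardy \<Rightarrow> real" where
  "norm x = H2_norm (coeff x)"
definition sgn_hardy :: "'a hardy \<Rightarrow> 'a hardy" where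
  "sgn (x :: 'a hardy) = inverse (norm x) *\<^sub>R x"
definition dist_hardy :: "'a hardy \<Rightarrow> 'a hardy \<Rightarrow> real" where
  "dist (x :: 'a hardy) y = norm (x - y)"
definition uniformity_hardy :: "('a hardy \<times> 'a hardy) filter" where
  "uniformity_hardy = (INF e\<in>{0 <..}. principal {(x :: 'a hardy, y). dist x y < e})"
definition open_hardy :: "'a hardy set \<Rightarrow> bool" where
  "open_hardy (S :: 'a hardy set) = (\<forall>x\<in>S. \<forall>\<^sub>F (x', y) in uniformity. x' = x \<longrightarrow> y \<in> S)"

lemma coeff_zero [simp]: "coeff 0 k = 0"
  by (simp add: zero_hardy_def Hardy_inverse H2_zero)

lemma coeff_add [simp]: "coeff (x + y) k = coeff x k + coeff y k"
  by (simp add: plus_hardy_def Hardy_inverse H2_add coeff)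

lemma coeff_diff [simp]: "coeff (x - y) k = coeff x k - coeff y k"
  by (simp add: minus_hardy_def Hardy_inverse H2_diff coeff)

lemma coeff_uminus [simp]: "coeff (- x) k = - coeff x k"
  by (simp add: uminus_hardy_def Hardy_inverse H2_uminus coeff)

lemma coeff_scaleR [simp]: "coeff (r *\<^sub>R x) k = r *\<^sub>R coeff x k"
  by (simp add: scaleR_hardy_def Hardy_inverse H2_scaleR coeff)

lemma summable_inner_coeff: "summable (\<lambda>k. inner (coeff x k) (coeff y k))"
  by (intro H2_summable_inner coeff)

instance
proof
  fix x y z :: "'a hardy" and r s :: real
  show "x + y + z = x + (y + z)" "x + y = y + x" "0 + x = x" "- x + x = 0" "x - y = x + - y"
    "r *\<^sub>R (x + y) = r *\<^sub>R x + r *\<^sub>R y" "(r + s) *\<^sub>R x = r *\<^sub>R x + s *\<^sub>R x"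
    "r *\<^sub>R s *\<^sub>R x = (r * s) *\<^sub>R x" "1 *\<^sub>R x = x"
    by (auto intro!: hardy_eqI simp: algebra_simps)
  show "inner x y = inner y x"
    by (simp add: inner_hardy_def inner_commute)
  show "inner (x + y) z = inner x z + inner y z"
    by (simp add: inner_hardy_def inner_add_left suminf_add summable_inner_coeff)
  show "inner (r *\<^sub>R x) y = r * inner x y"
    by (simp add: inner_hardy_def suminf_mult summable_inner_coeff)
  show "0 \<le> inner x x"
    by (simp add: inner_hardy_def suminf_nonneg summable_inner_coeff)
  show "inner x x = 0 \<longleftrightarrow> x = 0"
  proof
    assume "inner x x = 0"
    then have "\<forall>k. inner (coeff x k) (coeff x k) = 0"
      by (subst (asm) inner_hardy_def, subst (asm) suminf_eq_zero_iff) (auto simp: summable_inner_coeff)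
    then show "x = 0" by (auto intro: hardy_eqI)
  qed (simp add: inner_hardy_def)
  show "norm x = sqrt (inner x x)"
    by (simp add: norm_hardy_def H2_norm_def inner_hardy_def power2_norm_eq_inner)
qed (rule sgn_hardy_def dist_hardy_def uniformity_hardy_def open_hardy_def)+

end

lemma power2_norm_hardy: "(norm x)\<^sup>2 = (\<Sum>k. (norm (coeff x k))\<^sup>2)"
  by (simp add: power2_norm_eq_inner inner_hardy_def)

lemma summable_norm_coeff: "summable (\<lambda>k. (norm (coeff x k))\<^sup>2)"
  using coeff[of x] by (simp add: H2_def)

lemma sum_norm_coeff_le: "finite I \<Longrightarrow> (\<Sum>k\<in>I. (norm (coeff x k))\<^sup>2) \<le> (norm x)\<^sup>2"
  unfolding power2_norm_hardy by (intro sum_le_suminf summable_norm_coeff) auto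

lemma norm_coeff_le: "norm (coeff x k) \<le> norm x"
  by (rule power2_le_imp_le) (use sum_norm_coeff_le[of "{k}" x] in simp_all)

lemma coeff_sum: "coeff (\<Sum>i\<in>I. x i) k = (\<Sum>i\<in>I. coeff (x i) k)"
  by (induction I rule: infinite_finite_induct) auto

text \<open>A Cauchy sequence converges coefficientwise. Its Cauchy estimates pass to the limit on
  finite sums, with a bound independent of their length, and so give convergence in norm.\<close>

instance hardy :: ("{real_inner,complete_space}") complete_space
proof
  fix X :: "nat \<Rightarrow> 'a hardy"
  assume X: "Cauchy X"
  have "Cauchy (\<lambda>n. coeff (X n) k)" for k
    unfolding Cauchy_def
    by (metis (no_types, lifting) X Cauchy_def coeff_diff dist_norm norm_coeff_le order_le_less_trans)
  then have "\<forall>k. \<exists>l. (\<lambda>n. coeff (X n) k) \<longlonglongrightarrow> l"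
    using Cauchy_convergent convergent_def by blast
  then obtain a where a: "\<And>k. (\<lambda>n. coeff (X n) k) \<longlonglongrightarrow> a k"
    by metis
  have tail: "\<exists>M. \<forall>m\<ge>M. \<forall>I. (\<Sum>k<I. (norm (coeff (X m) k - a k))\<^sup>2) \<le> e\<^sup>2" if "e > 0" for e
  proof -
    obtain M where M: "\<And>m n. m \<ge> M \<Longrightarrow> n \<ge> M \<Longrightarrow> norm (X m - X n) < e"
      using X \<open>e > 0\<close> unfolding Cauchy_def dist_norm by blast
    have "(\<Sum>k<I. (norm (coeff (X m) k - a k))\<^sup>2) \<le> e\<^sup>2" if m: "m \<ge> M" for m I
    proof (rule LIMSEQ_le_const2)
      show "(\<lambda>n. \<Sum>k<I. (norm (coeff (X m) k - coeff (X n) k))\<^sup>2)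
          \<longlonglongrightarrow> (\<Sum>k<I. (norm (coeff (X m) k - a k))\<^sup>2)"
        by (intro tendsto_intros a)
      have "(\<Sum>k<I. (norm (coeff (X m) k - coeff (X n) k))\<^sup>2) \<le> e\<^sup>2" if "n \<ge> M" for n
      proof -
        have "(\<Sum>k<I. (norm (coeff (X m - X n) k))\<^sup>2) \<le> (norm (X m - X n))\<^sup>2"
          by (rule sum_norm_coeff_le) simp
        also have "\<dots> \<le> e\<^sup>2" using M[OF m that] by (intro power_mono) auto
        finally show ?thesis by simp
      qed
      then show "\<exists>M. \<forall>n\<ge>M. (\<Sum>k<I. (norm (coeff (X m) k - coeff (X n) k))\<^sup>2) \<le> e\<^sup>2" by blast
    qed
    then show ?thesis by blast
  qed
  have diff: "(\<lambda>k. coeff (X m) k - a k) \<in> H2"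
    if "\<forall>I. (\<Sum>k<I. (norm (coeff (X m) k - a k))\<^sup>2) \<le> e\<^sup>2" for m e
    using that unfolding H2_def by (auto intro: summableI_nonneg_bounded)
  obtain M where "\<forall>I. (\<Sum>k<I. (norm (coeff (X M) k - a k))\<^sup>2) \<le> 1\<^sup>2"
    using tail[of 1] by auto
  from H2_diff[OF coeff[of "X M"] diff[OF this]] have aH: "a \<in> H2" by simp
  have "X \<longlonglongrightarrow> Hardy a"
  proof (rule metric_LIMSEQ_I)
    fix r :: real assume "r > 0"
    then obtain M where M: "\<forall>m\<ge>M. \<forall>I. (\<Sum>k<I. (norm (coeff (X m) k - a k))\<^sup>2) \<le> (r/2)\<^sup>2"
      using tail[of "r/2"] by auto
    have "dist (X m) (Hardy a) < r" if "m \<ge> M" for m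
    proof -
      have c: "coeff (X m - Hardy a) = (\<lambda>k. coeff (X m) k - a k)"
        by (auto simp: Hardy_inverse[OF aH])
      have "(norm (X m - Hardy a))\<^sup>2 \<le> (r/2)\<^sup>2"
        unfolding power2_norm_hardy using M that summable_norm_coeff[of "X m - Hardy a"]
        unfolding c by (intro suminf_le_const) auto
      then have "norm (X m - Hardy a) \<le> r/2" by (rule power2_le_imp_le) (use \<open>r > 0\<close> in simp)
      then show ?thesis using \<open>r > 0\<close> by (simp add: dist_norm)
    qed
    then show "\<exists>M. \<forall>n\<ge>M. dist (X n) (Hardy a) < r" by blast
  qed
  then show "convergent X" by (auto simp: convergent_def)
qed

section \<open>Lacunary sets and tails of series\<close>

text \<open>If two elements differ by \<open>s\<close>, the larger one lies between \<open>s\<close>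
  and \<open>d / (d - 1) * s\<close>. Geometric growth allows only boundedly many elements in such a
  window, whatever \<open>s\<close> is.\<close>

lemma lacunary_bounded_differences:
  assumes "lacunary \<Lambda>"
  obtains L :: nat where "\<And>s. s > 0 \<Longrightarrow> finite {m \<in> \<Lambda>. m + s \<in> \<Lambda>}"
    "\<And>s. s > 0 \<Longrightarrow> card {m \<in> \<Lambda>. m + s \<in> \<Lambda>} \<le> L"
proof -
  obtain n :: "nat \<Rightarrow> nat" and d :: real where n: "strict_mono n" "\<Lambda> = range n" and d: "d > 1"
    and step: "\<And>k. real (n (Suc k)) \<ge> d * real (n k)"
    using assms unfolding lacunary_def by blast
  have growth: "d ^ i * real (n k) \<le> real (n (k + i))" for i k
  proof (induction i)
    case (Suc i)
    have "d ^ Suc i * real (n k) \<le> d * real (n (k + i))"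
      using mult_left_mono[OF Suc, of d] d by (simp add: mult.assoc)
    then show ?case using step[of "k + i"] by simp
  qed simp
  \<comment> \<open>\<open>L\<close> depends on \<open>d\<close> alone: \<open>L\<close> steps along
    the sequence leave the window.\<close>
  obtain L where L: "d / (d - 1) < d ^ L" using real_arch_pow[OF d] by blast
  have main: "finite {m \<in> \<Lambda>. m + s \<in> \<Lambda>} \<and> card {m \<in> \<Lambda>. m + s \<in> \<Lambda>} \<le> L" if s: "s > 0" for s
  proof -
    define B where "B = {b. \<exists>a. n b = n a + s}"
    have low: "real s \<le> real (n b)" if "b \<in> B" for b
      using that by (auto simp: B_def)
    have up: "(d - 1) * real (n b) \<le> d * real s" if b: "b \<in> B" for b
    proof -
      obtain a where a: "n b = n a + s" using b by (auto simp: B_def)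
      then have "n a < n b" using s by simp
      then have "Suc a \<le> b" using n(1) by (simp add: strict_mono_less Suc_leI)
      then have "n (Suc a) \<le> n b" using n(1) by (simp add: strict_mono_less_eq)
      then have "d * real (n a) \<le> real (n b)" using step[of a] by linarith
      then show ?thesis using a by (simp add: algebra_simps)
    qed
    have "B \<subseteq> {b0..<b0 + L}" if b0: "b0 \<in> B" "\<And>b. b \<in> B \<Longrightarrow> b0 \<le> b" for b0
    proof
      fix b assume b: "b \<in> B"
      have "b < b0 + L"
      proof (rule ccontr)
        assume "\<not> b < b0 + L"
        then have "n (b0 + L) \<le> n b" using n(1) by (simp add: strict_mono_less_eq)
        then have "d ^ L * real (n b0) \<le> real (n b)" using growth[of L b0] by linarith
        moreover have "d ^ L * real s \<le> d ^ L * real (n b0)"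
          using low[OF b0(1)] d by (intro mult_left_mono) auto
        moreover have "d / (d - 1) * real s < d ^ L * real s"
          using L s by (intro mult_strict_right_mono) auto
        moreover have "real (n b) \<le> d / (d - 1) * real s"
          using up[OF b] d by (simp add: field_simps)
        ultimately show False by linarith
      qed
      then show "b \<in> {b0..<b0 + L}" using b0(2)[OF b] by simp
    qed
    moreover have "\<exists>b0. b0 \<in> B \<and> (\<forall>b\<in>B. b0 \<le> b)" if "B \<noteq> {}"
      using that LeastI[of "\<lambda>b. b \<in> B"] Least_le[of "\<lambda>b. b \<in> B"] by blast
    ultimately have "\<exists>b0. B \<subseteq> {b0..<b0 + L}" by (cases "B = {}") blast+
    then obtain b0 where "B \<subseteq> {b0..<b0 + L}" ..
    then have B: "finite B" "card B \<le> L"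
      using card_mono[of "{b0..<b0 + L}" B] by (auto intro: finite_subset)
    \<comment> \<open>The smaller element of a pair is recovered from the index of the larger one,
      so counting \<open>B\<close> is enough.\<close>
    have "{m \<in> \<Lambda>. m + s \<in> \<Lambda>} \<subseteq> (\<lambda>b. n b - s) ` B"
    proof
      fix m assume "m \<in> {m \<in> \<Lambda>. m + s \<in> \<Lambda>}"
      then obtain a b where ab: "m = n a" "n b = m + s" using n(2) by auto
      then have "b \<in> B" unfolding B_def by blast
      then show "m \<in> (\<lambda>b. n b - s) ` B" using ab by (intro image_eqI[of _ _ b]) auto
    qed
    with B show ?thesis
      by (meson card_image_le card_mono finite_imageI finite_subset order_trans)
  qed
  then show ?thesis using that by blast
qed

text \<open>If the series converged, its sum beyond some \<open>M\<close> would be at most 1/2.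
  Since \<open>R\<close> decreases, replacing each denominator by \<open>R M\<close> only lowers the
  terms; but the numerators beyond \<open>M\<close> add up to \<open>R M\<close> itself.\<close>

lemma not_summable_div_tail:
  fixes \<beta> :: "nat \<Rightarrow> real"
  assumes nn: "\<And>n. 0 \<le> \<beta> n" and sm: "summable \<beta>" and pos: "\<And>n. 0 < (\<Sum>l. \<beta> (l + Suc n))"
  shows "\<not> summable (\<lambda>n. \<beta> n / (\<Sum>l. \<beta> (l + Suc n)))"
proof
  define R where "R n = (\<Sum>l. \<beta> (l + Suc n))" for n
  define q where "q n = \<beta> n / R n" for n
  assume "summable (\<lambda>n. \<beta> n / (\<Sum>l. \<beta> (l + Suc n)))"
  then have "summable q" by (simp add: q_def[abs_def] R_def)
  then obtain M where M: "\<And>m n. m \<ge> M \<Longrightarrow> norm (sum q {m..<n}) < 1/2"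
    unfolding summable_Cauchy using half_gt_zero[OF zero_less_one] by meson
  have sms: "summable (\<lambda>l. \<beta> (l + k))" for k using sm by (rule summable_ignore_initial_segment)
  have Rdec: "R (Suc n) \<le> R n" for n
    using suminf_split_head[OF sms[of "Suc n"]] nn[of "Suc n"] by (simp add: R_def)
  have Rmono: "R n \<le> R M" if "M \<le> n" for n
    using that by (induction rule: dec_induct) (auto intro: order_trans Rdec)
  have Rpos: "0 < R n" for n using pos by (simp add: R_def)
  have "(\<Sum>l<n. \<beta> (l + Suc M)) \<le> R M / 2" for n
  proof -
    have "(\<Sum>l<n. \<beta> (l + Suc M)) / R M = (\<Sum>l<n. \<beta> (l + Suc M) / R M)"
      by (simp add: sum_divide_distrib)
    also have "\<dots> \<le> (\<Sum>l<n. q (l + Suc M))"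
      unfolding q_def using Rpos Rmono nn by (intro sum_mono divide_left_mono) auto
    also have "\<dots> = sum q {0 + Suc M..<n + Suc M}"
      by (subst sum.shift_bounds_nat_ivl) (simp add: lessThan_atLeast0)
    also have "\<dots> \<le> 1/2" using M[of "0 + Suc M" "n + Suc M"] by auto
    finally show ?thesis using Rpos[of M] by (simp add: field_simps)
  qed
  then have "R M \<le> R M / 2"
    unfolding R_def[of M] by (intro suminf_le_const sms)
  then show False using Rpos[of M] by simp
qed

text \<open>Exchange the sums: \<phi> at \<open>t\<close> is counted once for each pair in \<Lambda>
  with difference \<open>Suc t\<close>, hence at most \<open>L\<close> times.\<close>

lemma summable_lacunary_gap_sums:
  fixes \<phi> :: "nat \<Rightarrow> real"
  assumes lac: "lacunary \<Lambda>" and nn: "\<And>t. 0 \<le> \<phi> t" and sm: "summable \<phi>"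
  shows "summable (\<lambda>n. if n \<in> \<Lambda> then \<Sum>t. if t + Suc n \<in> \<Lambda> then \<phi> t else 0 else 0)"
proof -
  obtain L where L: "\<And>s. s > 0 \<Longrightarrow> finite {m \<in> \<Lambda>. m + s \<in> \<Lambda>}"
    "\<And>s. s > 0 \<Longrightarrow> card {m \<in> \<Lambda>. m + s \<in> \<Lambda>} \<le> L"
    using lacunary_bounded_differences[OF lac] by metis
  define \<psi> where "\<psi> n t = (if n \<in> \<Lambda> \<and> t + Suc n \<in> \<Lambda> then \<phi> t else 0)" for n t
  have sm\<psi>: "summable (\<psi> n)" for n
    by (rule summable_comparison_test'[OF sm, of 0]) (auto simp: \<psi>_def nn)
  have eq: "(if n \<in> \<Lambda> then \<Sum>t. if t + Suc n \<in> \<Lambda> then \<phi> t else 0 else 0) = suminf (\<psi> n)" for n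
    by (simp add: \<psi>_def[abs_def])
  have "summable (\<lambda>n. suminf (\<psi> n))"
  proof (rule summableI_nonneg_bounded)
    show "0 \<le> suminf (\<psi> n)" for n by (intro suminf_nonneg sm\<psi>) (simp add: \<psi>_def nn)
    fix I
    have "(\<Sum>n<I. \<psi> n t) \<le> real L * \<phi> t" for t
    proof -
      have "(\<Sum>n<I. \<psi> n t) = (\<Sum>n\<in>{n \<in> {..<I}. n \<in> \<Lambda> \<and> t + Suc n \<in> \<Lambda>}. \<phi> t)"
        unfolding \<psi>_def by (rule sum.inter_filter[symmetric]) simp
      also have "\<dots> = real (card {n \<in> {..<I}. n \<in> \<Lambda> \<and> t + Suc n \<in> \<Lambda>}) * \<phi> t" by simp
      also have "\<dots> \<le> real L * \<phi> t"
      proof (rule mult_right_mono)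
        have "card {n \<in> {..<I}. n \<in> \<Lambda> \<and> t + Suc n \<in> \<Lambda>} \<le> card {m \<in> \<Lambda>. m + Suc t \<in> \<Lambda>}"
          by (intro card_mono L) (auto simp: add.commute)
        also have "\<dots> \<le> L" by (intro L) simp
        finally show "real (card {n \<in> {..<I}. n \<in> \<Lambda> \<and> t + Suc n \<in> \<Lambda>}) \<le> real L" by simp
      qed (rule nn)
      finally show ?thesis .
    qed
    then have "(\<Sum>t. \<Sum>n<I. \<psi> n t) \<le> (\<Sum>t. real L * \<phi> t)"
      by (intro suminf_le summable_sum summable_mult sm\<psi> sm)
    then show "(\<Sum>n<I. suminf (\<psi> n)) \<le> (\<Sum>t. real L * \<phi> t)"
      by (subst (asm) suminf_sum) (auto simp: sm\<psi>)
  qed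
  then show ?thesis unfolding eq .
qed

text \<open>By \<open>gap\<close> the relation \<open>zero\<close> starts at the index
  \<open>j\<close>, so its leading term is minus the rest of the series, to which Cauchy-Schwarz
  applies.\<close>

lemma inner_square_le_tails:
  fixes b g :: "nat \<Rightarrow> 'a::real_inner"
  assumes b: "b \<in> H2" and g: "g \<in> H2"
    and zero: "(\<Sum>s. inner (b (k + s)) (g s)) = 0" and gap: "\<And>s. s < j \<Longrightarrow> b (k + s) = 0"
    and supp: "\<And>n. n \<notin> \<Lambda> \<Longrightarrow> b n = 0"
  shows "(inner (b (k + j)) (g j))\<^sup>2 \<le> (\<Sum>t. (norm (b (t + Suc (k + j))))\<^sup>2) *
    (\<Sum>t. if t + Suc (k + j) \<in> \<Lambda> then (norm (g (t + Suc j)))\<^sup>2 else 0)"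
proof -
  define u where "u t = b (t + Suc (k + j))" for t
  \<comment> \<open>Cutting \<open>g\<close> off outside \<Lambda> changes no inner product, because
    \<open>b\<close> vanishes there, and gives the second factor the form treated in
    \<open>summable_lacunary_gap_sums\<close>.\<close>
  define v where "v t = (if t + Suc (k + j) \<in> \<Lambda> then g (t + Suc j) else 0)" for t
  have uH: "u \<in> H2" unfolding u_def by (rule H2_ignore_initial[OF b])
  have vH: "v \<in> H2"
    by (rule H2_norm_le[OF H2_ignore_initial[OF g, of "Suc j"]]) (simp add: v_def)
  have "(\<lambda>s. b (k + s)) \<in> H2" using H2_ignore_initial[OF b, of k] by (simp add: add.commute)
  from suminf_split_initial_segment[OF H2_summable_inner[OF this g], of "Suc j"] zero
  have "inner (b (k + j)) (g j) = - (\<Sum>t. inner (b (k + (t + Suc j))) (g (t + Suc j)))"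
    by (simp add: gap)
  also have "(\<lambda>t. inner (b (k + (t + Suc j))) (g (t + Suc j))) = (\<lambda>t. inner (u t) (v t))"
    by (auto simp: u_def v_def supp add_ac)
  also have "suminf \<dots> = inner (Hardy u) (Hardy v)"
    by (simp add: inner_hardy_def Hardy_inverse uH vH)
  finally have "(inner (b (k + j)) (g j))\<^sup>2 = (inner (Hardy u) (Hardy v))\<^sup>2" by simp
  also have "\<dots> \<le> inner (Hardy u) (Hardy u) * inner (Hardy v) (Hardy v)"
    by (rule Cauchy_Schwarz_ineq)
  also have "inner (Hardy u) (Hardy u) = (\<Sum>t. (norm (b (t + Suc (k + j))))\<^sup>2)"
    by (simp add: inner_hardy_def Hardy_inverse uH power2_norm_eq_inner u_def)
  also have "inner (Hardy v) (Hardy v) =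
      (\<Sum>t. if t + Suc (k + j) \<in> \<Lambda> then (norm (g (t + Suc j)))\<^sup>2 else 0)"
    unfolding inner_hardy_def by (auto simp: Hardy_inverse vH power2_norm_eq_inner v_def intro!: suminf_cong)
  finally show ?thesis .
qed

text \<open>The open sets where \<open>inner v x\<close> is nonzero cover \<open>K\<close>. On a
  finite subcover the sum of squares is continuous and positive, so it attains a positive
  minimum.\<close>

lemma compact_finite_inner_lower_bound:
  fixes K S :: "'a::real_inner set"
  assumes K: "compact K" and sep: "\<And>v. v \<in> K \<Longrightarrow> \<exists>x\<in>S. inner v x \<noteq> 0"
  obtains F c where "finite F" "F \<subseteq> S" "c > 0" "\<And>v. v \<in> K \<Longrightarrow> c \<le> (\<Sum>x\<in>F. (inner v x)\<^sup>2)"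
proof (cases "K = {}")
  case True
  then show ?thesis using that[of "{}" 1] by simp
next
  case False
  have op: "open {v. inner v x \<noteq> 0}" for x :: 'a
    by (intro open_Collect_neq continuous_intros)
  have "K \<subseteq> (\<Union>x\<in>S. {v. inner v x \<noteq> 0})" using sep by blast
  then obtain F where F: "F \<subseteq> S" "finite F" "K \<subseteq> (\<Union>x\<in>F. {v. inner v x \<noteq> 0})"
    using compactE_image[OF K, of S "\<lambda>x. {v. inner v x \<noteq> 0}"] op by blast
  have "continuous_on K (\<lambda>v. \<Sum>x\<in>F. (inner v x)\<^sup>2)" by (intro continuous_intros)
  then obtain v0 where v0: "v0 \<in> K" "\<And>v. v \<in> K \<Longrightarrow> (\<Sum>x\<in>F. (inner v0 x)\<^sup>2) \<le> (\<Sum>x\<in>F. (inner v x)\<^sup>2)"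
    using continuous_attains_inf[OF K False] by blast
  obtain x where "x \<in> F" "inner v0 x \<noteq> 0" using F(3) v0(1) by blast
  then have "0 < (\<Sum>x\<in>F. (inner v0 x)\<^sup>2)"
    using F(2) by (intro sum_pos2[of F x]) auto
  then show ?thesis using that[OF F(2,1) _ v0(2)] by blast
qed

section \<open>Cyclicity\<close>

lemma complex_structure_norm: "complex_structure J \<Longrightarrow> norm (J x) = norm x"
  by (simp add: complex_structure_def norm_eq_sqrt_inner)

lemma H2_complex_structure: "complex_structure J \<Longrightarrow> a \<in> H2 \<Longrightarrow> (\<lambda>k. J (a k)) \<in> H2"
  by (simp add: H2_def complex_structure_norm)

lemma inner_cscale_eq_0:
  assumes "complex_structure J" "inner x w = 0" "inner x (J w) = 0"
  shows "inner (cscale J c x) w = 0"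
  using assms by (simp add: cscale_def inner_add_left complex_structure_inner)

lemma backward_shift_funpow: "(backward_shift ^^ n) a j = a (n + j)"
  by (induction n arbitrary: j) (auto simp: backward_shift_def)

lemma backward_shift_power: "((backward_shift ^^ N) ^^ k) a j = a (N * k + j)"
  by (simp add: funpow_mult backward_shift_funpow mult.commute)


text \<open>\<open>orth\<close> and \<open>orthJ\<close> together express complex orthogonality of
  \<open>h\<close> to the orbit of \<open>f\<close>. A nonzero coefficient \<open>h p\<close> makes
  the series of \<open>(norm (b n))\<^sup>2 / R n\<close> both converge and diverge.\<close>

lemma lacunary_backward_orthogonal_eq_0:
  fixes J :: "'a::{real_inner, complete_space} \<Rightarrow> 'a"
  assumes J: "complex_structure J" and N: "N \<ge> 1" and lac: "lacunary \<Lambda>"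
    and f: "f \<in> H2" "spectrum_in f \<Lambda>" "completely_rel_compact J f"
    and blocks: "\<And>m. blocks_span_XN J N f m"
    and h: "h \<in> H2"
    and orth: "\<And>k. (\<Sum>s. inner (f (N * k + s)) (h s)) = 0"
    and orthJ: "\<And>k. (\<Sum>s. inner (f (N * k + s)) (J (h s))) = 0"
  shows "h p = 0"
proof (rule ccontr)
  assume hp: "h p \<noteq> 0"
  \<comment> \<open>Including \<open>J (h j)\<close> makes the real span of \<open>S r\<close> a
    complex subspace.\<close>
  define S where "S r = {x. \<exists>j. j mod N = r \<and> (x = h j \<or> x = J (h j))}" for r
  define E where "E r = closure (span (S r))" for r
  define P where "P r = proj_on (E r)" for r
  define b where "b n = P (n mod N) (f n)" for n
  have Esub: "subspace (E r)" and Ecl: "closed (E r)" for r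
    by (auto simp: E_def subspace_closure)
  have SE: "S r \<subseteq> E r" for r
    using span_superset[of "S r"] closure_subset[of "span (S r)"] by (auto simp: E_def)
  have linJ: "linear J" and JJ: "\<And>x. J (J x) = - x"
    using J by (auto simp: complex_structure_def)
  have blJ: "bounded_linear J"
    by (rule bounded_linear_intro[where K = 1])
      (auto simp: linear_add[OF linJ] linear_scale[OF linJ] complex_structure_norm[OF J])
  \<comment> \<open>\<open>J\<close> permutes the generators up to sign, and continuity carries the
    invariance to the closure.\<close>
  have JE: "J w \<in> E r" if "w \<in> E r" for w r
  proof -
    have "J x \<in> span (S r)" if x: "x \<in> S r" for x
    proof -
      obtain j where j: "j mod N = r" "x = h j \<or> x = J (h j)" using x unfolding S_def by blast
      then have "h j \<in> span (S r)" "J (h j) \<in> span (S r)" by (auto simp: S_def intro!: span_base)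
      then show ?thesis using j(2) JJ by (auto simp: span_neg)
    qed
    then have "J ` span (S r) \<subseteq> span (S r)"
      unfolding linear_span_image[OF linJ, symmetric] by (intro span_minimal) auto
    then have "closure (J ` span (S r)) \<subseteq> E r" unfolding E_def by (rule closure_mono)
    moreover have "J ` closure (span (S r)) \<subseteq> closure (J ` span (S r))"
      by (intro image_closure_subset linear_continuous_on blJ closed_closure closure_subset)
    ultimately show ?thesis using that by (auto simp: E_def)
  qed
  have Pproj: "orth_projection J (P r)" for r
    unfolding P_def by (rule orth_projection_proj_on[OF Esub Ecl J JE])
  have PE: "P r x \<in> E r" for r x unfolding P_def by (rule proj_on_mem[OF Esub Ecl])
  have innerP: "inner (P r x) w = inner x w" if "w \<in> E r" for r x w
    unfolding P_def by (rule inner_proj_on[OF Esub Ecl that])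
  have bH: "b \<in> H2"
    by (rule H2_norm_le[OF f(1)]) (simp add: b_def P_def norm_proj_on_le[OF Esub Ecl])
  have P0: "P r 0 = 0" for r
    using Pproj[of r] by (simp add: orth_projection_def bounded_linear.linear linear_0)
  have supp: "b n = 0" if "n \<notin> \<Lambda>" for n
  proof -
    have "f n = 0" using that f(2) by (auto simp: spectrum_in_def)
    then show ?thesis by (simp add: b_def P0)
  qed
  \<comment> \<open>The indices \<open>N * k + s\<close> and \<open>s\<close> have the same residue,
    so the orthogonality relations for \<open>f\<close> hold for \<open>b\<close> as well.\<close>
  have bf: "inner (b (N * k + s)) w = inner (f (N * k + s)) w" if "w \<in> S (s mod N)" for k s w
    using innerP[of w "s mod N" "f (N * k + s)"] SE that by (auto simp: b_def)

  \<comment> \<open>Otherwise component \<open>r\<close> of every block from \<open>M\<close> on is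
    orthogonal to \<open>h p\<close> and \<open>J (h p)\<close>, and by Pythagoras no combination of
    these blocks comes closer than \<open>norm (h p)\<close> to the vector with \<open>h p\<close>
    in slot \<open>r\<close> and zeros elsewhere.\<close>
  have infb: "\<exists>l\<ge>M. b l \<noteq> 0" for M
  proof (rule ccontr)
    assume "\<not> (\<exists>l\<ge>M. b l \<noteq> 0)"
    then have b0: "b l = 0" if "l \<ge> M" for l using that by blast
    define r where "r = p mod N"
    have rN: "r < N" using N by (simp add: r_def)
    obtain K c where K: "finite K" "K \<subseteq> {M..}" and
      lt: "sqrt (\<Sum>j<N. (norm ((if j = r then h p else 0) - (\<Sum>k\<in>K. cscale J (c k) (f (N * k + j)))))\<^sup>2)
        < norm (h p)"
      using blocks[of M, unfolded blocks_span_XN_def, THEN spec, of "\<lambda>j. if j = r then h p else 0",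
          THEN spec, of "norm (h p)", THEN mp] hp unfolding zero_less_norm_iff by blast
    define z where "z = (\<Sum>k\<in>K. cscale J (c k) (f (N * k + r)))"
    have "(norm (h p - z))\<^sup>2 \<le> (\<Sum>j<N. (norm ((if j = r then h p else 0) - (\<Sum>k\<in>K. cscale J (c k) (f (N * k + j)))))\<^sup>2)"
      using member_le_sum[of r "{..<N}" "\<lambda>j. (norm ((if j = r then h p else 0) - (\<Sum>k\<in>K. cscale J (c k) (f (N * k + j)))))\<^sup>2"] rN
      by (simp add: z_def)
    then have "norm (h p - z) < norm (h p)"
      using lt real_le_rsqrt by (meson order_le_less_trans)
    then have less: "(norm (h p - z))\<^sup>2 < (norm (h p))\<^sup>2" by (simp add: power_strict_mono)
    have "inner (f (N * k + r)) w = 0" if "k \<in> K" "w \<in> S r" for k w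
    proof -
      have "M \<le> k" using K(2) that(1) by auto
      moreover have "k \<le> N * k" using N by simp
      ultimately have "b (N * k + r) = 0" by (intro b0) linarith
      then show ?thesis using bf[of w r k] that(2) rN by simp
    qed
    moreover have "h p \<in> S r" "J (h p) \<in> S r" by (auto simp: S_def r_def)
    ultimately have "inner z (h p) = 0"
      unfolding z_def inner_sum_left by (intro sum.neutral ballI inner_cscale_eq_0[OF J]) auto
    then have "(norm (h p - z))\<^sup>2 = (norm (h p))\<^sup>2 + (norm z)\<^sup>2"
      by (simp add: power2_norm_eq_inner inner_diff inner_commute)
    then show False using less zero_le_power2[of "norm z"] by linarith
  qed

  \<comment> \<open>The tail excludes the index \<open>n\<close> itself; \<open>infb\<close> keeps
    it positive, so division by it is safe.\<close>
  define R where "R n = (\<Sum>t. (norm (b (t + Suc n)))\<^sup>2)" for n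
  have smb: "summable (\<lambda>t. (norm (b t))\<^sup>2)" using bH by (simp add: H2_def)
  have Rpos: "0 < R n" for n
  proof -
    obtain l where l: "l \<ge> Suc n" "b l \<noteq> 0" using infb by blast
    then show ?thesis unfolding R_def
      by (intro suminf_pos2[of _ "l - Suc n"] summable_ignore_initial_segment[OF smb]) auto
  qed

  \<comment> \<open>Each generator is \<open>g j\<close> with \<open>g\<close> either
    \<open>h\<close> or its image under \<open>J\<close>. The bound by \<open>R n * G n\<close>,
    divided by \<open>R n\<close>, leaves the summable \<open>G\<close>.\<close>
  have sum_coord: "summable (\<lambda>n. if n mod N = r then (inner (b n) x)\<^sup>2 / R n else 0)" if x: "x \<in> S r" for x r
  proof -
    obtain j where j: "j mod N = r" and "x = h j \<or> x = J (h j)"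
      using x unfolding S_def by blast
    then have "\<exists>g. (g = h \<or> g = (\<lambda>s. J (h s))) \<and> x = g j" by auto
    then obtain g where g: "g = h \<or> g = (\<lambda>s. J (h s))" and xg: "x = g j" by blast
    have gH: "g \<in> H2" using g h H2_complex_structure[OF J h] by auto
    have gS: "g s \<in> S (s mod N)" for s using g by (auto simp: S_def)
    have g0: "(\<Sum>s. inner (b (N * k + s)) (g s)) = 0" for k
      unfolding bf[OF gS] using g orth orthJ by auto
    have "finite {m \<in> \<Lambda>. m + t \<in> \<Lambda>}" if "t > 0" for t
      using lacunary_bounded_differences[OF lac] that by metis
    then have "finite (\<Union>t\<in>{1..j}. {m \<in> \<Lambda>. m + t \<in> \<Lambda>})" by (intro finite_UN_I) auto
    \<comment> \<open>Beyond \<open>B\<close>, no element of \<Lambda> is followed by another one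
      within distance \<open>j\<close>.\<close>
    then obtain B where B: "\<And>m t. 1 \<le> t \<Longrightarrow> t \<le> j \<Longrightarrow> m \<in> \<Lambda> \<Longrightarrow> m + t \<in> \<Lambda> \<Longrightarrow> m < B"
      unfolding finite_nat_set_iff_bounded by (metis (no_types, lifting) UN_I atLeastAtMost_iff mem_Collect_eq)
    define G where "G n = (if n \<in> \<Lambda> then \<Sum>t. if t + Suc n \<in> \<Lambda> then (norm (g (t + Suc j)))\<^sup>2 else 0 else 0)" for n
    have smg: "summable (\<lambda>t. (norm (g (t + Suc j)))\<^sup>2)"
      using H2_ignore_initial[OF gH, of "Suc j"] by (simp add: H2_def)
    have smG: "summable G" unfolding G_def
      by (intro summable_lacunary_gap_sums lac smg) simp
    have "summable (\<lambda>t. if t + Suc n \<in> \<Lambda> then (norm (g (t + Suc j)))\<^sup>2 else 0)" for n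
      by (rule summable_comparison_test'[OF smg, of 0]) simp
    then have Gnn: "0 \<le> G n" for n
      unfolding G_def by (simp add: suminf_nonneg)
    have bound: "(inner (b n) x)\<^sup>2 \<le> R n * G n" if n: "n \<ge> B + j" "n mod N = r" "n \<in> \<Lambda>" for n
    proof -
      have "N dvd n - j" using n j by (metis add_leD2 mod_eq_dvd_iff_nat)
      then obtain k where k: "n = N * k + j" using n(1) by (metis add_leD2 dvdE le_add_diff_inverse2)
      \<comment> \<open>An element \<open>N * k + s\<close> of \<Lambda> would precede
        \<open>n\<close> by \<open>j - s\<close>, hence lie below \<open>B\<close>, whereas
        \<open>n\<close> being at least \<open>B + j\<close> gives \<open>N * k\<close> at least
        \<open>B\<close>.\<close>
      have gap: "b (N * k + s) = 0" if "s < j" for s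
      proof (rule supp, rule notI)
        assume "N * k + s \<in> \<Lambda>"
        moreover have "N * k + s + (j - s) = n" using that k by simp
        ultimately have "N * k + s < B" using B[of "j - s" "N * k + s"] that n(3) by auto
        then show False using n(1) k by simp
      qed
      show ?thesis
        using inner_square_le_tails[where k = "N * k" and j = j and \<Lambda> = \<Lambda>, OF bH gH g0 gap supp] n(3)
        unfolding R_def G_def xg k by simp
    qed
    show ?thesis
    proof (rule summable_comparison_test'[OF smG])
      fix n assume n: "n \<ge> B + j"
      show "norm (if n mod N = r then (inner (b n) x)\<^sup>2 / R n else 0) \<le> G n"
      proof (cases "n mod N = r \<and> n \<in> \<Lambda>")
        case True
        then show ?thesis using bound[OF n] Rpos[of n] by (simp add: field_simps)
      next
        case False
        then show ?thesis using supp[of n] Gnn[of n] by auto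
      qed
    qed
  qed

  have sum_res: "summable (\<lambda>n. if n mod N = r then (norm (b n))\<^sup>2 / R n else 0)" for r
  proof -
    define U where "U = {P r (f k) /\<^sub>R norm (P r (f k)) | k. P r (f k) \<noteq> 0}"
    have cU: "compact (closure U)"
      using f(3) Pproj unfolding completely_rel_compact_def U_def by blast
    \<comment> \<open>Limits of normalised vectors remain unit vectors in \<open>E r\<close>; one
      orthogonal to \<open>S r\<close> would be orthogonal to itself.\<close>
    have "\<exists>x\<in>S r. inner v x \<noteq> 0" if v: "v \<in> closure U" for v
    proof (rule ccontr)
      assume "\<not> ?thesis"
      then have v0: "inner v x = 0" if "x \<in> S r" for x using that by blast
      have "closed {w::'a. norm w = 1}" by (intro closed_Collect_eq continuous_intros)
      then have "closure U \<subseteq> E r \<inter> {w. norm w = 1}"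
        by (intro closure_minimal closed_Int Ecl) (auto simp: U_def PE subspace_scale[OF Esub])
      then have vE: "v \<in> E r" and v1: "norm v = 1" using v by auto
      have "subspace {w. inner v w = 0}" by (auto simp: subspace_def inner_add_right)
      then have "span (S r) \<subseteq> {w. inner v w = 0}" using v0 by (intro span_minimal) auto
      moreover have "closed {w. inner v w = 0}" by (intro closed_Collect_eq continuous_intros)
      ultimately have "E r \<subseteq> {w. inner v w = 0}" unfolding E_def by (rule closure_minimal)
      then show False using vE v1 by auto
    qed
    from compact_finite_inner_lower_bound[OF cU this]
    obtain F c where F: "finite F" "F \<subseteq> S r" and c: "c > 0"
      and low: "\<And>v. v \<in> closure U \<Longrightarrow> c \<le> (\<Sum>x\<in>F. (inner v x)\<^sup>2)" by blast
    \<comment> \<open>The bound on unit vectors is rescaled by homogeneity; \<open>b n = 0\<close>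
      is trivial.\<close>
    have low': "c * (norm (b n))\<^sup>2 \<le> (\<Sum>x\<in>F. (inner (b n) x)\<^sup>2)" if n: "n mod N = r" for n
    proof (cases "b n = 0")
      case False
      have "b n /\<^sub>R norm (b n) \<in> closure U"
        using False n closure_subset[of U] by (auto simp: U_def b_def)
      from low[OF this] have "c \<le> (\<Sum>x\<in>F. (inner (b n) x)\<^sup>2) / (norm (b n))\<^sup>2"
        by (simp add: power_mult_distrib power_divide divide_inverse sum_distrib_left sum_distrib_right mult.commute power_inverse)
      then show ?thesis using False by (simp add: field_simps)
    qed simp
    have "summable (\<lambda>n. (1 / c) * (\<Sum>x\<in>F. if n mod N = r then (inner (b n) x)\<^sup>2 / R n else 0))"
      using F(2) by (intro summable_mult summable_sum sum_coord) auto
    then show ?thesis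
    proof (rule summable_comparison_test'[where N = 0])
      fix n
      show "norm (if n mod N = r then (norm (b n))\<^sup>2 / R n else 0)
        \<le> (1 / c) * (\<Sum>x\<in>F. if n mod N = r then (inner (b n) x)\<^sup>2 / R n else 0)"
      proof (cases "n mod N = r")
        case True
        have "(norm (b n))\<^sup>2 / R n \<le> (1 / c) * ((\<Sum>x\<in>F. (inner (b n) x)\<^sup>2) / R n)"
          using low'[OF True] c Rpos[of n] by (simp add: field_simps)
        then show ?thesis using True Rpos[of n] by (simp add: sum_divide_distrib)
      qed simp
    qed
  qed

  \<comment> \<open>Every \<open>n\<close> has exactly one residue below \<open>N\<close>, so adding
    over \<open>r\<close> restores the full series.\<close>
  have "summable (\<lambda>n. \<Sum>r<N. if n mod N = r then (norm (b n))\<^sup>2 / R n else 0)"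
    by (intro summable_sum sum_res)
  moreover have "(\<Sum>r<N. if n mod N = r then (norm (b n))\<^sup>2 / R n else 0) = (norm (b n))\<^sup>2 / R n" for n
    using N by (subst sum.delta') auto
  ultimately have "summable (\<lambda>n. (norm (b n))\<^sup>2 / R n)" by simp
  moreover have "\<not> summable (\<lambda>n. (norm (b n))\<^sup>2 / R n)"
    using not_summable_div_tail[of "\<lambda>n. (norm (b n))\<^sup>2"] smb Rpos by (simp add: R_def)
  ultimately show False by contradiction
qed

text \<open>With one index range for both families, the two real coefficients at \<open>k\<close>
  can later be read as the real and imaginary parts of one complex coefficient.\<close>

lemma span_range_Un_range:
  fixes F G :: "nat \<Rightarrow> 'b::real_vector"
  assumes "v \<in> span (range F \<union> range G)"
  shows "\<exists>n \<alpha> \<beta>. v = (\<Sum>k<n. \<alpha> k *\<^sub>R F k + \<beta> k *\<^sub>R G k)"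
  using assms
proof (induction rule: span_induct_alt)
  case base
  show ?case by (intro exI[of _ 0]) simp
next
  case (step c x y)
  then obtain n \<alpha> \<beta> where y: "y = (\<Sum>k<n. \<alpha> k *\<^sub>R F k + \<beta> k *\<^sub>R G k)" by blast
  obtain i where i: "x = F i \<or> x = G i" using step by blast
  \<comment> \<open>The range is enlarged to contain \<open>i\<close>, and the old coefficients are
    padded by zeros.\<close>
  define n' where "n' = max n (Suc i)"
  define \<alpha>' where "\<alpha>' k = (if k < n then \<alpha> k else 0)" for k
  define \<beta>' where "\<beta>' k = (if k < n then \<beta> k else 0)" for k
  have y': "y = (\<Sum>k<n'. \<alpha>' k *\<^sub>R F k + \<beta>' k *\<^sub>R G k)"
    unfolding y by (rule sum.mono_neutral_cong_left) (auto simp: n'_def \<alpha>'_def \<beta>'_def)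
  have delta: "(\<Sum>k<n'. (if k = i then c else 0) *\<^sub>R H k) = c *\<^sub>R H i" for H :: "nat \<Rightarrow> 'b"
    by (simp add: if_distrib[of "\<lambda>t. t *\<^sub>R _"] n'_def less_max_iff_disj cong: if_cong)
  from i show ?case
  proof
    assume "x = F i"
    then have "c *\<^sub>R x + y = (\<Sum>k<n'. (\<alpha>' k + (if k = i then c else 0)) *\<^sub>R F k + \<beta>' k *\<^sub>R G k)"
      unfolding y' scaleR_add_left sum.distrib delta by simp
    then show ?case
      by (intro exI[of _ n'] exI[of _ "\<lambda>k. \<alpha>' k + (if k = i then c else 0)"] exI[of _ \<beta>'])
  next
    assume "x = G i"
    then have "c *\<^sub>R x + y = (\<Sum>k<n'. \<alpha>' k *\<^sub>R F k + (\<beta>' k + (if k = i then c else 0)) *\<^sub>R G k)"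
      unfolding y' scaleR_add_left sum.distrib delta by simp
    then show ?case
      by (intro exI[of _ n'] exI[of _ \<alpha>'] exI[of _ "\<lambda>k. \<beta>' k + (if k = i then c else 0)"])
  qed
qed

section \<open>Necessity and sufficiency of the span condition\<close>

lemma H2_sum: "(\<And>i. i \<in> K \<Longrightarrow> a i \<in> H2) \<Longrightarrow> (\<lambda>j. \<Sum>i\<in>K. a i j) \<in> H2"
  by (induction K rule: infinite_finite_induct) (auto intro: H2_zero H2_add)

text \<open>Place \<open>y\<close> in the window of length \<open>N\<close> starting at
  \<open>N * m\<close>. There the \<open>k\<close>-th orbit element shows the block of index
  \<open>k + m\<close>, so approximating \<open>g\<close> in norm approximates \<open>y\<close> by
  blocks of index at least \<open>m\<close>.\<close>

lemma cyclic_imp_blocks_span: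
  fixes J :: "'a::real_inner \<Rightarrow> 'a"
  assumes J: "complex_structure J" and f: "f \<in> H2"
    and cyc: "cyclic_for_power_backward_shift J N f"
  shows "blocks_span_XN J N f m"
  unfolding blocks_span_XN_def
proof (intro allI impI)
  fix y :: "nat \<Rightarrow> 'a" and e :: real assume e: "e > 0"
  define g where "g j = (if N * m \<le> j \<and> j < N * m + N then y (j - N * m) else 0)" for j
  have gH: "g \<in> H2"
    unfolding H2_def by (auto intro!: summable_finite[of "{N * m..<N * m + N}"] simp: g_def)
  obtain K c where K: "finite K"
    and lt: "H2_norm (\<lambda>j. g j - (\<Sum>k\<in>K. cscale J (c k) (f (N * k + j)))) < e"
    using cyc gH e unfolding cyclic_for_power_backward_shift_def backward_shift_power by blast
  define D where "D j = g j - (\<Sum>k\<in>K. cscale J (c k) (f (N * k + j)))" for j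
  have fk: "(\<lambda>j. f (N * k + j)) \<in> H2" for k
    using H2_ignore_initial[OF f, of "N * k"] by (simp add: add.commute)
  have "D \<in> H2" unfolding D_def cscale_def
    by (intro H2_diff gH H2_sum H2_add H2_scaleR fk H2_complex_structure[OF J])
  then have "(\<Sum>j\<in>(\<lambda>j. N * m + j) ` {..<N}. (norm (D j))\<^sup>2) \<le> (\<Sum>j. (norm (D j))\<^sup>2)"
    by (intro sum_le_suminf) (auto simp: H2_def)
  then have "(\<Sum>j<N. (norm (D (N * m + j)))\<^sup>2) \<le> (\<Sum>j. (norm (D j))\<^sup>2)"
    by (subst (asm) sum.reindex) (auto simp: inj_on_def)
  then have "sqrt (\<Sum>j<N. (norm (D (N * m + j)))\<^sup>2) \<le> H2_norm D"
    by (simp add: H2_norm_def)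
  also have "\<dots> < e" using lt by (simp add: D_def[abs_def])
  finally have "sqrt (\<Sum>j<N. (norm (D (N * m + j)))\<^sup>2) < e" .
  \<comment> \<open>Reindexing by \<open>k + m\<close>; the subtraction in \<open>c (k - m)\<close>
    is exact on the image.\<close>
  moreover have "D (N * m + j) = y j - (\<Sum>k\<in>(\<lambda>k. k + m) ` K. cscale J (c (k - m)) (f (N * k + j)))"
    if "j < N" for j
    unfolding D_def using that by (subst sum.reindex) (auto simp: g_def algebra_simps)
  ultimately have "sqrt (\<Sum>j<N. (norm (y j - (\<Sum>k\<in>(\<lambda>k. k + m) ` K. cscale J (c (k - m)) (f (N * k + j)))))\<^sup>2) < e"
    by simp
  then show "\<exists>K c. finite K \<and> K \<subseteq> {m..} \<and>
      sqrt (\<Sum>j<N. (norm (y j - (\<Sum>k\<in>K. cscale J (c k) (f (N * k + j)))))\<^sup>2) < e"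
    using K by (intro exI[of _ "(\<lambda>k. k + m) ` K"] exI[of _ "\<lambda>k. c (k - m)"]) auto
qed

text \<open>Density is tested on the orthogonal complement. The family \<open>G\<close>, the orbit
  multiplied by \<open>J\<close>, turns the complex span of the orbit into a real one.\<close>

lemma cyclic_if_no_orthogonal:
  fixes J :: "'a::{real_inner, complete_space} \<Rightarrow> 'a"
  assumes J: "complex_structure J" and f: "f \<in> H2"
    and orth: "\<And>h p. h \<in> H2 \<Longrightarrow> (\<And>k. (\<Sum>s. inner (f (N * k + s)) (h s)) = 0) \<Longrightarrow>
      (\<And>k. (\<Sum>s. inner (f (N * k + s)) (J (h s))) = 0) \<Longrightarrow> h p = 0"
  shows "cyclic_for_power_backward_shift J N f"
  unfolding cyclic_for_power_backward_shift_def backward_shift_power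
proof (intro ballI allI impI)
  fix g :: "nat \<Rightarrow> 'a" and e :: real assume g: "g \<in> H2" and e: "e > 0"
  have fk: "(\<lambda>j. f (N * k + j)) \<in> H2" for k
    using H2_ignore_initial[OF f, of "N * k"] by (simp add: add.commute)
  define F where "F k = Hardy (\<lambda>j. f (N * k + j))" for k
  define G where "G k = Hardy (\<lambda>j. J (f (N * k + j)))" for k
  have cF: "coeff (F k) j = f (N * k + j)" for k j
    by (simp add: F_def Hardy_inverse fk)
  have cG: "coeff (G k) j = J (f (N * k + j))" for k j
    by (simp add: G_def Hardy_inverse H2_complex_structure[OF J fk])
  have "closure (span (range F \<union> range G)) = UNIV"
  proof (rule closure_subspace_eq_UNIV)
    fix h assume h: "\<And>v. v \<in> span (range F \<union> range G) \<Longrightarrow> inner h v = 0"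
    have "inner (F k) h = 0" "inner (G k) h = 0" for k
      by (metis UnCI h inner_commute rangeI span_base)+
    \<comment> \<open>Moving \<open>J\<close> from \<open>f\<close> to \<open>h\<close> costs the
      sign in the second relation.\<close>
    then have "(\<Sum>s. inner (f (N * k + s)) (coeff h s)) = 0"
      "(\<Sum>s. - inner (f (N * k + s)) (J (coeff h s))) = 0" for k
      by (simp_all add: inner_hardy_def cF cG complex_structure_inner[OF J])
    then have "coeff h p = 0" for p
      using H2_summable_inner[OF fk H2_complex_structure[OF J coeff]]
      by (intro orth coeff) (auto simp: suminf_minus)
    then show "h = 0" by (intro hardy_eqI) simp
  qed (rule subspace_span)
  then obtain v where v: "v \<in> span (range F \<union> range G)" "dist v (Hardy g) < e"
    using e closure_approachable[of "Hardy g"] by blast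
  obtain n \<alpha> \<beta> where n: "v = (\<Sum>k<n. \<alpha> k *\<^sub>R F k + \<beta> k *\<^sub>R G k)"
    using span_range_Un_range[OF v(1)] by blast
  have "H2_norm (\<lambda>j. g j - (\<Sum>k<n. cscale J (Complex (\<alpha> k) (\<beta> k)) (f (N * k + j)))) = norm (Hardy g - v)"
    unfolding norm_hardy_def by (rule arg_cong[of _ _ H2_norm])
      (auto simp: Hardy_inverse g n coeff_sum cF cG cscale_def)
  then show "\<exists>K c. finite K \<and> H2_norm (\<lambda>j. g j - (\<Sum>k\<in>K. cscale J (c k) (f (N * k + j)))) < e"
    using v(2) by (intro exI[of _ "{..<n}"] exI[of _ "\<lambda>k. Complex (\<alpha> k) (\<beta> k)"])
      (auto simp: dist_norm norm_minus_commute)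
qed

theorem mainTheorem9:
  fixes J :: "'a::{real_inner, complete_space} \<Rightarrow> 'a"
    and N :: nat and \<Lambda> :: "nat set" and f :: "nat \<Rightarrow> 'a"
  assumes "complex_structure J"
    and "separable_space TYPE('a)"
    and "N \<ge> 1"
    and "lacunary \<Lambda>"
    and "f \<in> H2" and "spectrum_in f \<Lambda>"
    and "completely_rel_compact J f"
  shows "cyclic_for_power_backward_shift J N f \<longleftrightarrow> (\<forall>m. blocks_span_XN J N f m)"
proof
  assume "cyclic_for_power_backward_shift J N f"
  then show "\<forall>m. blocks_span_XN J N f m"
    using cyclic_imp_blocks_span assms(1,5) by blast
next
  assume "\<forall>m. blocks_span_XN J N f m"
  then show "cyclic_for_power_backward_shift J N f"
    by (intro cyclic_if_no_orthogonal lacunary_backward_orthogonal_eq_0[where J = J and N = N and f = f and \<Lambda> = \<Lambda>] assms) auto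
qed

end
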